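(* Let $\mathcal{G}$ be a class of (finite, unweighted) graphs such that every graph is a minor of some graph in $\mathcal{G}$. Then (a) $\mathrm{asdim}(\mathcal{G}_{\mathbb{R}^+})=\infty$; (b) $\mathrm{ANdim}(\mathcal{G}_{\mathbb{N}})=\infty$; and (c) if $\mathcal{G}$ is closed under subdivision, then $\mathrm{ANdim}(\mathcal{G})=\infty$.
   Context: $\mathbb{R}^+$ denotes the strictly positive reals and $\mathbb{N}=\{1,2,\dots\}$. A weighted graph has edge weights in $\mathbb{R}^+\cup\{\infty\}$; unweighted graphs carry weight $1$ on every edge; $\mathrm{dist}_G$ is shortest path length. For $S\subseteq\mathbb{R}^+$, the $S$-weights completion $\mathcal{G}_S$ of $\mathcal{G}$ is the class of weighted graphs all of whose edge weights lie in $S$ and whose underlying unweighted graph is in $\mathcal{G}$. $\mathrm{wdiam}_G(X)=\max_{u,v\in X}\mathrm{dist}_G(u,v)$. For $r>0$ an $r$-path is a sequence of vertices with consecutive vertices at distance at most $r$ in $G$. A map $c:V(G)\to C$, $|C|=m$, is an $(m,r,d)$-colouring if every $r$-path whose vertices all receive the same colour has weak diameter in $G$ at most $d$. $f:\mathbb{R}^+\to\mathbb{R}^+$ is an $n$-dimensional control function for a class if every member admits an $(n+1,r,f(r))$-colouring for every $r>0$. The asymptotic dimension $\mathrm{asdim}$ of a class is the least $n\geq0$ such that it admits an $n$-dimensional control function; the Assouad--Nagata dimension $\mathrm{ANdim}$ is the least $n\geq0$ such that it admits an $n$-dimensional control function $f$ that is a dilation (i.e. $f(r)\leq cr$ for some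 $c>0$ and all $r>0$); each is $\infty$ if no such $n$ exists. $\mathcal{G}$ is closed under subdivision if every graph obtained from a member by replacing edges with paths is a member. *)

theory Defs
  imports
    "Graph_Theory.Graph_Theory"
    "HOL-Library.Extended_Nat"
    "HOL-Library.Disjoint_Sets"
begin

text \<open>
  A finite simple graph is a \<^locale>\<open>pair_graph\<close>: an undirected edge is the pair of
  its two opposite arcs.  A weighted graph is such a graph together with a weight function on arcs
  that gives both arcs of an edge the same weight.  Only finite weights occur here.
\<close>

type_synonym 'a weighted_graph = "'a pair_pre_digraph \<times> ('a \<times> 'a) weight_fun"


subsection \<open>Minors, subdivisions, completions\<close>

text \<open>
  The graph \<open>H\<close> is (isomorphic to) a minor of \<open>G\<close> if it has a model in \<open>G\<close>.  Branch sets are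
  nonempty because \<^const>\<open>Digraph_Component.connected\<close> excludes the empty graph.
\<close>

definition minor :: "'b pair_pre_digraph \<Rightarrow> 'a pair_pre_digraph \<Rightarrow> bool" where
  "minor H G \<longleftrightarrow> (\<exists>B :: 'b \<Rightarrow> 'a set.
     (\<forall>x \<in> pverts H. B x \<subseteq> pverts G \<and> Digraph_Component.connected (with_proj G \<restriction> B x)) \<and>
     disjoint_family_on B (pverts H) \<and>
     (\<forall>(x, y) \<in> parcs H. \<exists>u \<in> B x. \<exists>v \<in> B y. (u, v) \<in> parcs G))"

definition closed_under_subdivision :: "'a pair_pre_digraph set \<Rightarrow> bool" where
  "closed_under_subdivision \<G> \<longleftrightarrow> (\<forall>G \<in> \<G>. \<forall>H. subdivision_pair G H \<longrightarrow> H \<in> \<G>)"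

definition weights_completion ::
    "real set \<Rightarrow> 'a pair_pre_digraph set \<Rightarrow> 'a weighted_graph set" where
  "weights_completion S \<G> =
     {(G, w). G \<in> \<G> \<and> (\<forall>(u, v) \<in> parcs G. w (u, v) \<in> S \<and> w (v, u) = w (u, v))}"

definition unit_weights :: "'a pair_pre_digraph set \<Rightarrow> 'a weighted_graph set" where
  "unit_weights \<G> = (\<lambda>G. (G, \<lambda>_. 1)) ` \<G>"


subsection \<open>Distances and colourings\<close>

text \<open>The distance of vertices in different components is \<open>\<infinity>\<close>.\<close>

definition gdist :: "'a weighted_graph \<Rightarrow> 'a \<Rightarrow> 'a \<Rightarrow> ereal" where
  "gdist W u v = wf_digraph.\<mu> (with_proj (fst W)) (snd W) u v"

definition wdiam :: "'a weighted_graph \<Rightarrow> 'a set \<Rightarrow> ereal" where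
  "wdiam W X = (SUP u \<in> X. SUP v \<in> X. gdist W u v)"

definition r_path :: "'a weighted_graph \<Rightarrow> real \<Rightarrow> 'a list \<Rightarrow> bool" where
  "r_path W r p \<longleftrightarrow> p \<noteq> [] \<and> set p \<subseteq> pverts (fst W) \<and>
     successively (\<lambda>u v. gdist W u v \<le> ereal r) p"

definition colouring ::
    "'a weighted_graph \<Rightarrow> nat \<Rightarrow> real \<Rightarrow> real \<Rightarrow> ('a \<Rightarrow> nat) \<Rightarrow> bool" where
  "colouring W m r d c \<longleftrightarrow> c ` pverts (fst W) \<subseteq> {..<m} \<and>
     (\<forall>p. r_path W r p \<and> (\<exists>i. \<forall>v \<in> set p. c v = i) \<longrightarrow> wdiam W (set p) \<le> ereal d)"


subsection \<open>Asymptotic and Assouad--Nagata dimension\<close>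

definition control_function ::
    "nat \<Rightarrow> (real \<Rightarrow> real) \<Rightarrow> 'a weighted_graph set \<Rightarrow> bool" where
  "control_function n f \<W> \<longleftrightarrow> (\<forall>r>0. f r > 0) \<and>
     (\<forall>W \<in> \<W>. \<forall>r>0. \<exists>c. colouring W (n + 1) r (f r) c)"

definition dilation :: "(real \<Rightarrow> real) \<Rightarrow> bool" where
  "dilation f \<longleftrightarrow> (\<exists>c>0. \<forall>r>0. f r \<le> c * r)"

text \<open>In \<^typ>\<open>enat\<close> the infimum of a nonempty set is its least element, and \<open>Inf {} = \<infinity>\<close>.\<close>

definition asdim :: "'a weighted_graph set \<Rightarrow> enat" where
  "asdim \<W> = Inf (enat ` {n. \<exists>f. control_function n f \<W>})"

definition ANdim :: "'a weighted_graph set \<Rightarrow> enat" where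
  "ANdim \<W> = Inf (enat ` {n. \<exists>f. control_function n f \<W> \<and> dilation f})"

end

theory Submission
  imports Defs "HOL-Analysis.Brouwer_Fixpoint"
begin

text \<open>
  In any colouring of the grid \<open>{0..p}^d\<close> with \<open>d\<close> colours, some colour \<open>i\<close> contains a path joining
  the two faces perpendicular to the \<open>i\<close>-th axis (up to distance 1). Some member \<open>G\<close> of the class
  has this grid as a minor. Edges inside branch sets get weight 1 and edges between them a weight
  proportional to a large \<open>K\<close>; then \<open>G\<close> contains a copy of the grid scaled by \<open>K\<close>, with
  distances bounded from below by the coordinate functions, which are Lipschitz potentials. So no
  colouring with \<open>d\<close> colours at scale \<open>r \<sim> K * d\<close> has a bound below \<open>K * (p - 2)\<close>, and \<open>p\<close> is
  arbitrary. Dividing the weights by \<open>K\<close> makes \<open>r\<close> independent of \<open>p\<close>, which gives (a); the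
  integer weights give (b); subdividing each edge according to its weight, and interpolating the
  potentials linearly, gives (c).
\<close>

section \<open>A Hex lemma for grids\<close>

text \<open>Adjacency is distance at most 2 in the sup norm, wider than in the usual grid. The
  points are extensional functions, which makes the vertex set finite.\<close>

definition grid :: "nat \<Rightarrow> nat \<Rightarrow> (nat \<Rightarrow> nat) pair_pre_digraph" where
  "grid d p = \<lparr>pverts = {..<d} \<rightarrow>\<^sub>E {..p},
     parcs = {(x, y). x \<in> {..<d} \<rightarrow>\<^sub>E {..p} \<and> y \<in> {..<d} \<rightarrow>\<^sub>E {..p} \<and> x \<noteq> y \<and>
                (\<forall>j<d. \<bar>int (x j) - int (y j)\<bar> \<le> 2)}\<rparr>"

lemma pair_graphI:
  assumes "finite (pverts G)" "parcs G \<subseteq> pverts G \<times> pverts G" "sym (parcs G)" "irrefl (parcs G)"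
  shows "pair_graph G"
proof
  show "finite (parcs G)"
    using assms(1,2) by (meson finite_SigmaI finite_subset)
  show "symmetric (with_proj G)"
    using assms(3) by (simp add: symmetric_def)
qed (use assms in \<open>auto simp: irrefl_def\<close>)

lemma pair_graph_grid: "pair_graph (grid d p)"
  by (rule pair_graphI) (auto simp: grid_def sym_def irrefl_def finite_PiE abs_minus_commute)

text \<open>The bound on \<open>set q\<close> controls the intermediate points: all but the start
  lie in the range of the relation, so that the whole path inherits the colour and the grid
  membership built into it.\<close>

lemma rtrancl_imp_successively:
  assumes "(x, y) \<in> R\<^sup>*"
  shows "\<exists>q. q \<noteq> [] \<and> hd q = x \<and> last q = y \<and> successively (\<lambda>u v. (u, v) \<in> R) q \<and>
             set q \<subseteq> insert x (Range R)"
  using assms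
proof (induction rule: rtrancl_induct)
  case base
  then show ?case by (intro exI[of _ "[x]"]) auto
next
  case (step y z)
  then obtain q where q: "q \<noteq> []" "hd q = x" "last q = y"
    "successively (\<lambda>u v. (u, v) \<in> R) q" "set q \<subseteq> insert x (Range R)"
    by blast
  then show ?case
    using step.hyps(2) by (intro exI[of _ "q @ [z]"]) (auto simp: successively_append_iff)
qed

text \<open>If no colour class joins its two faces, label coordinate \<open>i\<close> of \<open>x\<close> by 0 iff \<open>x i = 0\<close> or \<open>x\<close> is
  within 1 of the part \<open>A i\<close> of colour class \<open>i\<close> that is reachable from the low face. In the cell
  given by Kuhn's lemma, the label of the lowest corner's own colour changes, so that this corner
  is within 2 of \<open>A i\<close> and hence in \<open>A i\<close>, but also has a neighbour that is not near \<open>A i\<close>. Points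
  at distance 2 are adjacent in \<^const>\<open>grid\<close> for this reason.\<close>

lemma hex_grid:
  fixes c :: "(nat \<Rightarrow> nat) \<Rightarrow> nat"
  assumes "0 < p" and c: "\<And>x. x \<in> pverts (grid d p) \<Longrightarrow> c x < d"
  obtains i q where "i < d" "q \<noteq> []" "set q \<subseteq> pverts (grid d p)" "\<forall>x \<in> set q. c x = i"
    "successively (\<lambda>x y. (x, y) \<in> parcs (grid d p)) q" "hd q i \<le> 1" "p \<le> last q i + 1"
proof -
  define V where "V = pverts (grid d p)"
  define R where "R i = {(x, y) \<in> parcs (grid d p). c x = i \<and> c y = i}" for i
  define A where "A i = {a. \<exists>b\<in>V. c b = i \<and> b i \<le> 1 \<and> (b, a) \<in> (R i)\<^sup>*}" for i
  have AV: "a \<in> V \<and> c a = i" if aA: "a \<in> A i" for a i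
  proof -
    obtain b where b: "b \<in> V" "c b = i" "(b, a) \<in> (R i)\<^sup>*"
      using aA by (auto simp: A_def)
    show ?thesis
      using b(3,1,2) by (cases rule: rtranclE) (auto simp: R_def V_def grid_def)
  qed
  have "\<exists>i<d. \<exists>a\<in>A i. p \<le> a i + 1"
  proof (rule ccontr)
    assume "\<not> ?thesis"
    then have low: "a i + 1 < p" if "i < d" "a \<in> A i" for i a
      using that by force
    define near where "near x i \<longleftrightarrow> (\<exists>a\<in>A i. \<forall>j<d. \<bar>int (x j) - int (a j)\<bar> \<le> 1)" for x i
    define label where "label x i = (if x i = 0 \<or> near x i then 0 else 1 :: nat)" for x i
    \<comment> \<open>A point of \<open>A i\<close> within 1 of \<open>x\<close> would have
      \<open>i\<close>-th coordinate at least \<open>p - 1\<close>, against \<open>low\<close>; and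
      \<open>x i = 0\<close> is excluded by \<open>0 < p\<close>.\<close>
    have label_top: "label x i = 1" if "i < d" "x i = p" for x i
      using that low \<open>0 < p\<close> by (force simp: label_def near_def)
    \<comment> \<open>Kuhn's lemma yields a unit cell with lowest corner \<open>q\<close> in which
      each of the \<open>d\<close> labels takes both values.\<close>
    obtain q where q: "\<forall>i<d. q i < p"
      and change: "\<forall>i<d. \<exists>r s. (\<forall>j<d. q j \<le> r j \<and> r j \<le> q j + 1) \<and>
            (\<forall>j<d. q j \<le> s j \<and> s j \<le> q j + 1) \<and> label r i \<noteq> label s i"
    proof (rule kuhn_lemma[OF \<open>0 < p\<close>, of d label])
      show "\<forall>x. (\<forall>i<d. x i \<le> p) \<longrightarrow> (\<forall>i<d. label x i = 0 \<or> label x i = 1)"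
        "\<forall>x. (\<forall>i<d. x i \<le> p) \<longrightarrow> (\<forall>i<d. x i = 0 \<longrightarrow> label x i = 0)"
        by (auto simp: label_def)
      show "\<forall>x. (\<forall>i<d. x i \<le> p) \<longrightarrow> (\<forall>i<d. x i = p \<longrightarrow> label x i = 1)"
        using label_top by blast
    qed blast
    \<comment> \<open>\<open>q\<close> is controlled only at indices below \<open>d\<close>; the
      restriction turns it into a vertex of the grid.\<close>
    define x where "x = restrict q {..<d}"
    have xV: "x \<in> V"
      using q by (auto simp: x_def V_def grid_def less_imp_le)
    define i where "i = c x"
    have "i < d"
      using c xV by (simp add: i_def V_def)
    obtain r s where r: "\<And>j. j < d \<Longrightarrow> x j \<le> r j \<and> r j \<le> x j + 1"
      and s: "\<And>j. j < d \<Longrightarrow> x j \<le> s j \<and> s j \<le> x j + 1" and "label r i = 0" "label s i = 1"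
    proof -
      obtain r s where rs: "\<forall>j<d. q j \<le> r j \<and> r j \<le> q j + 1"
          "\<forall>j<d. q j \<le> s j \<and> s j \<le> q j + 1" "label r i \<noteq> label s i"
        using change \<open>i < d\<close> by blast
      then consider "label r i = 0" "label s i = 1" | "label s i = 0" "label r i = 1"
        by (auto simp: label_def split: if_splits)
      then show ?thesis
        using that[of r s] that[of s r] rs(1,2) by cases (auto simp: x_def)
    qed
    have "s i \<noteq> 0" "\<not> near s i"
      using \<open>label s i = 1\<close> by (auto simp: label_def split: if_splits)
    have "x \<notin> A i"
    proof
      assume "x \<in> A i"
      moreover have "\<forall>j<d. \<bar>int (s j) - int (x j)\<bar> \<le> 1"
        using s by fastforce
      ultimately show False
        using \<open>\<not> near s i\<close> by (auto simp: near_def)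
    qed
    \<comment> \<open>Otherwise the empty path would put \<open>x\<close>, which has colour
      \<open>i\<close>, into \<open>A i\<close>. Hence \<open>r\<close> owes its label 0 to nearness
      to \<open>A i\<close> and not to the face \<open>r i = 0\<close>.\<close>
    then have "\<not> x i \<le> 1"
      using xV by (auto simp: A_def i_def)
    with r[OF \<open>i < d\<close>] have "r i \<noteq> 0" by simp
    then have "near r i"
      using \<open>label r i = 0\<close> by (auto simp: label_def split: if_splits)
    then obtain a where a: "a \<in> A i" "\<forall>j<d. \<bar>int (r j) - int (a j)\<bar> \<le> 1"
      by (auto simp: near_def)
    have "\<bar>int (a j) - int (x j)\<bar> \<le> 2" if "j < d" for j
      using r[OF that] a(2) that by fastforce
    moreover have "a \<noteq> x"
      using a(1) \<open>x \<notin> A i\<close> by blast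
    ultimately have "(a, x) \<in> R i"
      using AV[OF a(1)] xV by (auto simp: R_def V_def grid_def i_def)
    then have "x \<in> A i"
      using a(1) by (auto simp: A_def intro: rtrancl_into_rtrancl)
    with \<open>x \<notin> A i\<close> show False ..
  qed
  then obtain i a b where i: "i < d" "p \<le> a i + 1" and b: "b \<in> V" "c b = i" "b i \<le> 1"
    "(b, a) \<in> (R i)\<^sup>*"
    by (auto simp: A_def)
  from rtrancl_imp_successively[OF b(4)] obtain q where q: "q \<noteq> []" "hd q = b" "last q = a"
    "successively (\<lambda>u v. (u, v) \<in> R i) q" "set q \<subseteq> insert b (Range (R i))"
    by blast
  have *: "x \<in> V \<and> c x = i" if "x \<in> set q" for x
    using that q(5) b by (auto simp: R_def V_def grid_def)
  show ?thesis
  proof (rule that[OF i(1) q(1)])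
    show "successively (\<lambda>x y. (x, y) \<in> parcs (grid d p)) q"
      using q(4) by (rule successively_mono) (auto simp: R_def)
  qed (use * q b i in \<open>auto simp: V_def\<close>)
qed


section \<open>Distance estimates\<close>

lemma gdist_le_awalk_cost:
  assumes "pair_graph G" "pre_digraph.awalk (with_proj G) u p v"
  shows "gdist (G, w) u v \<le> ereal (wf_digraph.awalk_cost w p)"
proof -
  interpret pair_graph G by fact
  show ?thesis
    using min_cost_le_walk_cost[of u p v w] assms(2) by (simp add: gdist_def)
qed

text \<open>The differences of \<open>\<phi>\<close> telescope along any walk from \<open>u\<close>
  to \<open>v\<close>. If there is no walk, the distance is an infimum over the empty set, hence
  infinite.\<close>

lemma gdist_ge_potential:
  fixes \<phi> :: "'a \<Rightarrow> real"
  assumes "pair_graph G" and lip: "\<And>u v. (u, v) \<in> parcs G \<Longrightarrow> \<phi> u - \<phi> v \<le> w (u, v)"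
  shows "ereal (\<phi> u - \<phi> v) \<le> gdist (G, w) u v"
proof -
  interpret pair_graph G by fact
  have "\<phi> u - \<phi> v \<le> awalk_cost w p" if "awalk u p v" for p
    using that
  proof (induction p arbitrary: u)
    case Nil
    then show ?case by (simp add: awalk_simps)
  next
    case (Cons e p)
    then have "\<phi> (snd e) - \<phi> v \<le> awalk_cost w p" "\<phi> u - \<phi> (snd e) \<le> w e"
      using lip[of u "snd e"] by (auto simp: awalk_simps)
    then show ?case by simp
  qed
  then show ?thesis
    by (auto simp: gdist_def \<mu>_def intro!: INF_greatest)
qed

text \<open>Each arc of a walk in \<open>G\<close> is replaced by a walk in \<open>G'\<close> that
  costs no more, and the pieces are concatenated. The inclusion of the vertex sets covers the empty
  walk.\<close>

lemma gdist_le_gdist: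
  assumes "pair_graph G" "pair_graph G'" "pverts G \<subseteq> pverts G'"
    and step: "\<And>u v. (u, v) \<in> parcs G \<Longrightarrow>
      \<exists>p. pre_digraph.awalk (with_proj G') u p v \<and> wf_digraph.awalk_cost w' p \<le> w (u, v)"
  shows "gdist (G', w') u v \<le> gdist (G, w) u v"
proof -
  interpret G: pair_graph G by fact
  interpret G': pair_graph G' by fact
  have "\<exists>p'. G'.awalk u p' v \<and> G'.awalk_cost w' p' \<le> G.awalk_cost w p" if "G.awalk u p v" for p
    using that
  proof (induction p arbitrary: u)
    case Nil
    then show ?case using assms(3) by (intro exI[of _ "[]"]) (auto simp: G.awalk_simps G'.awalk_simps)
  next
    case (Cons e p)
    then have e: "e = (u, snd e)" "e \<in> parcs G" "G.awalk (snd e) p v"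
      by (auto simp: G.awalk_simps)
    obtain p1 where p1: "G'.awalk u p1 (snd e)" "G'.awalk_cost w' p1 \<le> w e"
      using step[of u "snd e"] e by auto
    obtain p2 where p2: "G'.awalk (snd e) p2 v" "G'.awalk_cost w' p2 \<le> G.awalk_cost w p"
      using Cons.IH[OF e(3)] by blast
    show ?case
      using G'.awalk_appendI[OF p1(1) p2(1)] p1(2) p2(2)
      by (intro exI[of _ "p1 @ p2"]) auto
  qed
  then show ?thesis
    unfolding gdist_def fst_conv snd_conv G.\<mu>_def G'.\<mu>_def
    by (intro INF_mono) auto
qed

text \<open>The colouring is pulled back along \<open>\<rho>\<close> to the grid. The monochromatic
  path found there maps to a monochromatic \<open>r\<close>-path, whose two ends are far apart by
  the lower bound in the coordinate \<open>i\<close> given by its colour.\<close>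

lemma grid_not_colouring:
  fixes \<rho> :: "(nat \<Rightarrow> nat) \<Rightarrow> 'a"
  assumes "0 < p" and \<rho>: "\<And>x. x \<in> pverts (grid d p) \<Longrightarrow> \<rho> x \<in> pverts (fst W)"
    and up: "\<And>x y. (x, y) \<in> parcs (grid d p) \<Longrightarrow> gdist W (\<rho> x) (\<rho> y) \<le> ereal r"
    and lo: "\<And>i x y. i < d \<Longrightarrow> x \<in> pverts (grid d p) \<Longrightarrow> y \<in> pverts (grid d p) \<Longrightarrow>
      ereal (s * (real (x i) - real (y i))) \<le> gdist W (\<rho> x) (\<rho> y)"
    and "0 \<le> s" "D < s * (real p - 2)"
  shows "\<not> colouring W d r D c"
proof
  assume col: "colouring W d r D c"
  then have "c (\<rho> x) < d" if "x \<in> pverts (grid d p)" for x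
    using \<rho>[OF that] by (auto simp: colouring_def)
  then obtain i q where q: "i < d" "q \<noteq> []" "set q \<subseteq> pverts (grid d p)" "\<forall>x \<in> set q. c (\<rho> x) = i"
    "successively (\<lambda>x y. (x, y) \<in> parcs (grid d p)) q" "hd q i \<le> 1" "p \<le> last q i + 1"
    using hex_grid[OF \<open>0 < p\<close>, of d "c \<circ> \<rho>"] by (metis comp_apply)
  have "successively (\<lambda>x y. gdist W (\<rho> x) (\<rho> y) \<le> ereal r) q"
    using q(5) by (rule successively_mono) (auto intro: up)
  then have "r_path W r (map \<rho> q)"
    using q(2,3) \<rho> by (auto simp: r_path_def successively_map)
  moreover have "\<forall>v\<in>set (map \<rho> q). c v = i"
    using q(4) by simp
  ultimately have "wdiam W (set (map \<rho> q)) \<le> ereal D"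
    using col unfolding colouring_def by blast
  moreover have "gdist W (\<rho> (last q)) (\<rho> (hd q)) \<le> wdiam W (set (map \<rho> q))"
    unfolding wdiam_def using q(2) by (intro SUP_upper2[of "\<rho> (last q)"] SUP_upper2[of "\<rho> (hd q)"]) auto
  moreover have "ereal (s * (real (last q i) - real (hd q i))) \<le> gdist W (\<rho> (last q)) (\<rho> (hd q))"
    using q(1-3) by (intro lo) auto
  ultimately have "ereal (s * (real (last q i) - real (hd q i))) \<le> ereal D"
    by (meson order_trans)
  \<comment> \<open>The ends of the path are only known to be within 1 of the two faces, which costs
    2 in the difference of coordinates.\<close>
  moreover have "s * (real p - 2) \<le> s * (real (last q i) - real (hd q i))"
    using q(6,7) \<open>0 \<le> s\<close> by (intro mult_left_mono) auto
  ultimately show False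
    using \<open>D < s * (real p - 2)\<close> by simp
qed

section \<open>Weights on a graph with a given minor\<close>

lemma minorE:
  assumes "minor H G"
  obtains B where "\<forall>x \<in> pverts H. B x \<subseteq> pverts G"
    "\<forall>x \<in> pverts H. Digraph_Component.connected (with_proj G \<restriction> B x)"
    "disjoint_family_on B (pverts H)"
    "\<forall>x y. (x, y) \<in> parcs H \<longrightarrow> (\<exists>u \<in> B x. \<exists>v \<in> B y. (u, v) \<in> parcs G)"
proof -
  obtain B where
    "(\<forall>x \<in> pverts H. B x \<subseteq> pverts G \<and> Digraph_Component.connected (with_proj G \<restriction> B x)) \<and>
     disjoint_family_on B (pverts H) \<and>
     (\<forall>(x, y) \<in> parcs H. \<exists>u \<in> B x. \<exists>v \<in> B y. (u, v) \<in> parcs G)"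
    using assms unfolding minor_def ..
  then show ?thesis
    by (intro that[of B]) auto
qed

text \<open>A finite graph is copied onto natural numbers by an injection \<open>h\<close>, and the
  branch sets of the copy are pulled back. This makes the hypothesis applicable to the grid, whose
  vertices are functions.\<close>

lemma minor_nat_imp_minor:
  fixes H :: "'b pair_pre_digraph"
  assumes "\<forall>H :: nat pair_pre_digraph. pair_graph H \<longrightarrow> (\<exists>G \<in> \<G>. minor H G)" and "pair_graph H"
  shows "\<exists>G \<in> \<G>. minor H G"
proof -
  interpret H: pair_graph H by fact
  obtain h :: "'b \<Rightarrow> nat" where h: "inj_on h (pverts H)"
    using finite_imp_inj_to_nat_seg[OF H.pair_finite_verts] by blast
  define H' where "H' = \<lparr>pverts = h ` pverts H, parcs = map_prod h h ` parcs H\<rparr>"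
  have "irrefl (parcs H')"
    using h H.no_loops' H.wellformed' by (fastforce simp: H'_def irrefl_def inj_on_eq_iff)
  moreover have "sym (parcs H')"
    using H.arcs_symmetric by (fastforce simp: H'_def sym_def)
  ultimately have "pair_graph H'"
    using H.pair_finite_verts H.wellformed' by (intro pair_graphI) (auto simp: H'_def)
  then obtain G where "G \<in> \<G>" "minor H' G"
    using assms(1) by blast
  from \<open>minor H' G\<close> obtain B where B [rule_format]: "\<forall>x \<in> pverts H'. B x \<subseteq> pverts G"
     "\<forall>x \<in> pverts H'. Digraph_Component.connected (with_proj G \<restriction> B x)"
     "disjoint_family_on B (pverts H')"
     "\<forall>x y. (x, y) \<in> parcs H' \<longrightarrow> (\<exists>u \<in> B x. \<exists>v \<in> B y. (u, v) \<in> parcs G)"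
    by (rule minorE)
  have "minor H G"
    unfolding minor_def
  proof (intro exI[of _ "B \<circ> h"] conjI ballI)
    show "disjoint_family_on (B \<circ> h) (pverts H)"
      using B(3) h by (auto simp: disjoint_family_on_def H'_def inj_on_eq_iff)
    show "case e of (x, y) \<Rightarrow> \<exists>u\<in>(B \<circ> h) x. \<exists>v\<in>(B \<circ> h) y. (u, v) \<in> parcs G" if "e \<in> parcs H" for e
      using that B(4)[of "h (fst e)" "h (snd e)"] by (force simp: H'_def)
  qed (use B(1,2) in \<open>auto simp: H'_def\<close>)
  with \<open>G \<in> \<G>\<close> show ?thesis ..
qed

text \<open>An edgeless graph with more vertices than \<open>'a\<close> has elements cannot be a
  minor, because its branch sets are disjoint and nonempty. Infinity of the type supplies the fresh
  vertices for subdivisions.\<close>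

lemma infinite_UNIV_if_all_minors:
  fixes \<G> :: "'a pair_pre_digraph set"
  assumes "\<forall>H :: nat pair_pre_digraph. pair_graph H \<longrightarrow> (\<exists>G \<in> \<G>. minor H G)"
  shows "infinite (UNIV :: 'a set)"
proof
  assume fin: "finite (UNIV :: 'a set)"
  define H :: "nat pair_pre_digraph" where "H = \<lparr>pverts = {..card (UNIV :: 'a set)}, parcs = {}\<rparr>"
  have "pair_graph H"
    by (rule pair_graphI) (auto simp: H_def sym_def irrefl_def)
  then obtain G where "G \<in> \<G>" "minor H G"
    using assms by blast
  from \<open>minor H G\<close> obtain B :: "nat \<Rightarrow> 'a set" where "disjoint_family_on B (pverts H)"
    and conn [rule_format]: "\<forall>x \<in> pverts H. Digraph_Component.connected (with_proj G \<restriction> B x)"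
    by (rule minorE)
  moreover have "B x \<noteq> {}" if "x \<in> pverts H" for x
    using conn[OF that] by (auto simp: connected_conv)
  ultimately have "inj_on (\<lambda>x. SOME u. u \<in> B x) (pverts H)"
    by (intro inj_onI) (metis disjoint_family_on_def disjoint_iff some_in_eq)
  then have "card (pverts H) \<le> card (UNIV :: 'a set)"
    using fin by (metis card_inj_on_le subset_UNIV)
  then show False
    by (simp add: H_def)
qed

text \<open>Symmetry turns connectedness into strong connectedness, and the walk can be taken
  without repeated vertices. This gives a length bound that is the same for all branch sets.\<close>

lemma connected_induce_subgraph_awalk:
  assumes "pair_graph G" "S \<subseteq> pverts G" "Digraph_Component.connected (with_proj G \<restriction> S)"
    "u \<in> S" "v \<in> S"
  obtains p where "pre_digraph.awalk (with_proj G) u p v" "set p \<subseteq> S \<times> S"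
    "length p \<le> card (pverts G)"
proof -
  interpret G: pair_graph G by fact
  let ?S = "with_proj G \<restriction> S"
  have ind: "induced_subgraph ?S (with_proj G)"
    using assms(2) by (auto intro: G.induced_induce)
  interpret S: wf_digraph ?S
    using ind by (rule wf_digraphI_induced)
  have "Digraph.symmetric ?S"
    using G.sym_arcs ind by (rule induced_graph_imp_symmetric)
  then have "strongly_connected ?S"
    using assms(3) by (rule S.symmetric_connected_imp_strongly_connected)
  then have "u \<rightarrow>\<^sup>*\<^bsub>?S\<^esub> v"
    using assms(4,5) by (auto simp: strongly_connected_def)
  then obtain p where p: "S.apath u p v"
    by (metis S.reachable_awalk S.apath_awalk_to_apath)
  then have "G.apath u p v"
    using G.subgraph_apath_imp_apath ind induced_imp_subgraph by blast
  moreover have "set p \<subseteq> S \<times> S"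
    using p by (auto simp: S.apath_def S.awalk_def)
  ultimately show ?thesis
    using that G.length_apath by (auto simp: G.apath_def)
qed

text \<open>Branch sets are shrunk by giving their edges weight \<open>1\<close>, negligible against the scale \<open>K\<close>; all
  other edges are long enough that \<open>K * f i\<close>, extended by \<open>0\<close> outside the branch sets, is
  1-Lipschitz.\<close>

lemma minor_weights:
  fixes f :: "nat \<Rightarrow> 'b \<Rightarrow> int" and G :: "'a pair_pre_digraph"
  assumes "pair_graph G" "minor H G" "pair_graph H"
    and f: "\<And>i x y. i < d \<Longrightarrow> (x, y) \<in> parcs H \<Longrightarrow> \<bar>f i x - f i y\<bar> \<le> int L"
  obtains K :: nat and w :: "'a \<times> 'a \<Rightarrow> nat" and \<rho> :: "'b \<Rightarrow> 'a" and \<phi> :: "nat \<Rightarrow> 'a \<Rightarrow> int"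
  where "0 < K" "\<And>x. x \<in> pverts H \<Longrightarrow> \<rho> x \<in> pverts G"
    "\<And>e. 1 \<le> w e" "\<And>u v. w (v, u) = w (u, v)"
    "\<And>i u v. i < d \<Longrightarrow> \<phi> i u - \<phi> i v \<le> int (w (u, v))"
    "\<And>i x. x \<in> pverts H \<Longrightarrow> \<phi> i (\<rho> x) = int K * f i x"
    "\<And>x y. (x, y) \<in> parcs H \<Longrightarrow> \<exists>p. pre_digraph.awalk (with_proj G) (\<rho> x) p (\<rho> y) \<and>
       sum_list (map w p) \<le> (d * L + 1) * K"
proof -
  interpret G: pair_graph G by fact
  interpret H: pair_graph H by fact
  obtain B where B [rule_format]: "\<forall>x \<in> pverts H. B x \<subseteq> pverts G"
     "\<forall>x \<in> pverts H. Digraph_Component.connected (with_proj G \<restriction> B x)"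
    and disj: "disjoint_family_on B (pverts H)"
    and arcs [rule_format]: "\<forall>x y. (x, y) \<in> parcs H \<longrightarrow> (\<exists>u \<in> B x. \<exists>v \<in> B y. (u, v) \<in> parcs G)"
    using assms(2) by (rule minorE)
  define \<rho> where "\<rho> x = (SOME u. u \<in> B x)" for x
  have \<rho>: "\<rho> x \<in> B x" if "x \<in> pverts H" for x
    using B(2)[OF that] by (auto simp: \<rho>_def connected_conv some_in_eq)
  \<comment> \<open>Room for two paths inside branch sets, each of length at most
    \<open>card (pverts G)\<close>, and for the summand 1 in the weight of the arc between
    them.\<close>
  define K where "K = 2 * card (pverts G) + 1"
  define \<phi> where "\<phi> i u = (if \<exists>x\<in>pverts H. u \<in> B x
      then int K * f i (THE x. x \<in> pverts H \<and> u \<in> B x) else 0)" for i u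
  have \<phi>: "\<phi> i u = int K * f i x" if "x \<in> pverts H" "u \<in> B x" for i u x
  proof -
    have "(THE x. x \<in> pverts H \<and> u \<in> B x) = x"
      using that disj by (intro the_equality) (auto simp: disjoint_family_on_def)
    then show ?thesis using that by (auto simp: \<phi>_def)
  qed
  \<comment> \<open>Summing the variations of all potentials makes every one of them 1-Lipschitz at
    once. The sum vanishes inside a branch set, where the potentials are constant, so that weight 1
    remains there.\<close>
  define w where "w e = 1 + (\<Sum>i<d. nat \<bar>\<phi> i (fst e) - \<phi> i (snd e)\<bar>)" for e
  have lip: "\<phi> i u - \<phi> i v \<le> int (w (u, v))" if "i < d" for i u v
  proof -
    have "\<bar>\<phi> i u - \<phi> i v\<bar> \<le> (\<Sum>i<d. \<bar>\<phi> i u - \<phi> i v\<bar>)"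
      using that by (intro member_le_sum) auto
    then show ?thesis by (simp add: w_def)
  qed
  have w_sym: "w (v, u) = w (u, v)" for u v
    by (simp add: w_def abs_minus_commute)
  have walk: "\<exists>p. G.awalk (\<rho> x) p (\<rho> y) \<and> sum_list (map w p) \<le> (d * L + 1) * K"
    if xy: "(x, y) \<in> parcs H" for x y
  proof -
    have V: "x \<in> pverts H" "y \<in> pverts H"
      using xy by (auto dest: H.wellformed')
    have w_branch: "sum_list (map w p) = length p" if "z \<in> pverts H" "set p \<subseteq> B z \<times> B z" for p z
    proof -
      have "w e = 1" if "e \<in> B z \<times> B z" for e
        using that \<phi>[OF \<open>z \<in> pverts H\<close>] by (auto simp: w_def)
      then show ?thesis
        using \<open>set p \<subseteq> B z \<times> B z\<close> by (induction p) auto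
    qed
    obtain u v where uv: "u \<in> B x" "v \<in> B y" "(u, v) \<in> parcs G"
      using arcs[OF xy] by blast
    obtain p1 where p1: "G.awalk (\<rho> x) p1 u" "set p1 \<subseteq> B x \<times> B x" "length p1 \<le> card (pverts G)"
      using connected_induce_subgraph_awalk[OF assms(1) B[OF V(1)] \<rho>[OF V(1)] uv(1)] by blast
    obtain p2 where p2: "G.awalk v p2 (\<rho> y)" "set p2 \<subseteq> B y \<times> B y" "length p2 \<le> card (pverts G)"
      using connected_induce_subgraph_awalk[OF assms(1) B[OF V(2)] uv(2) \<rho>[OF V(2)]] by blast
    have "G.awalk u ((u, v) # p2) (\<rho> y)"
      using p2(1) uv(3) by (simp add: G.awalk_simps)
    with p1(1) have walk: "G.awalk (\<rho> x) (p1 @ (u, v) # p2) (\<rho> y)"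
      by (rule G.awalk_appendI)
    \<comment> \<open>The crossing arc weighs at most \<open>1 + d * (K * L)\<close>; together with
      the two inner paths this stays below \<open>K + d * (K * L)\<close>.\<close>
    have "nat \<bar>\<phi> i u - \<phi> i v\<bar> \<le> K * L" if "i < d" for i
    proof -
      have "\<bar>\<phi> i u - \<phi> i v\<bar> = int K * \<bar>f i x - f i y\<bar>"
        by (simp add: \<phi>[OF V(1) uv(1)] \<phi>[OF V(2) uv(2)] abs_mult flip: right_diff_distrib)
      also have "\<dots> \<le> int K * int L"
        using f[OF that xy] by (intro mult_left_mono) auto
      finally show ?thesis by (simp add: nat_le_iff)
    qed
    then have "(\<Sum>i<d. nat \<bar>\<phi> i u - \<phi> i v\<bar>) \<le> d * (K * L)"
      using sum_bounded_above[of "{..<d}" "\<lambda>i. nat \<bar>\<phi> i u - \<phi> i v\<bar>" "K * L"] by simp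
    then have "w (u, v) \<le> 1 + d * (K * L)"
      by (simp add: w_def)
    moreover have "length p1 + length p2 + 1 \<le> K"
      using p1(3) p2(3) by (simp add: K_def)
    moreover have "(d * L + 1) * K = K + d * (K * L)"
      by (simp add: algebra_simps)
    moreover have "sum_list (map w (p1 @ (u, v) # p2)) = length p1 + w (u, v) + length p2"
      using w_branch[OF V(1) p1(2)] w_branch[OF V(2) p2(2)] by simp
    ultimately have "sum_list (map w (p1 @ (u, v) # p2)) \<le> (d * L + 1) * K"
      by linarith
    then show ?thesis
      using walk by blast
  qed
  show ?thesis
  proof (rule that[of K \<rho> w \<phi>])
    show "\<rho> x \<in> pverts G" if "x \<in> pverts H" for x
      using \<rho>[OF that] B(1)[OF that] by blast
    show "\<phi> i (\<rho> x) = int K * f i x" if "x \<in> pverts H" for i x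
      using \<phi>[OF that \<rho>[OF that]] .
    show "0 < K" by (simp add: K_def)
    show "1 \<le> w e" for e by (simp add: w_def)
  qed (fact w_sym lip walk)+
qed

section \<open>Subdividing down to unit weights\<close>

text \<open>An edge of weight at least 2 is split into edges of weight 1 and
  \<open>w (a, b) - 1\<close>, by induction on the total excess of the weights over 1. Extending the
  potentials to the new vertices preserves lower bounds on distances, while the comparison of
  \<open>gdist\<close> preserves upper bounds.\<close>

lemma subdivide_to_unit_weights:
  fixes w :: "'a \<times> 'a \<Rightarrow> nat" and G :: "'a pair_pre_digraph" and \<phi> :: "'i \<Rightarrow> 'a \<Rightarrow> real"
  assumes "infinite (UNIV :: 'a set)" "pair_graph G"
    and "\<And>u v. (u, v) \<in> parcs G \<Longrightarrow> 1 \<le> w (u, v) \<and> w (v, u) = w (u, v)"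
    and "\<And>i u v. (u, v) \<in> parcs G \<Longrightarrow> \<phi> i u - \<phi> i v \<le> w (u, v)"
  shows "\<exists>G' \<phi>'. subdivision_pair G G' \<and> pverts G \<subseteq> pverts G' \<and>
    (\<forall>i. \<forall>u\<in>pverts G. \<phi>' i u = \<phi> i u) \<and>
    (\<forall>i. \<forall>(u, v)\<in>parcs G'. \<phi>' i u - \<phi>' i v \<le> 1) \<and>
    (\<forall>u v. gdist (G', \<lambda>_. 1) u v \<le> gdist (G, \<lambda>e. real (w e)) u v)"
  using assms(2-4)
proof (induction "\<Sum>e\<in>parcs G. w e - 1" arbitrary: G w \<phi> rule: less_induct)
  case less
  interpret G: pair_graph G by (rule less.prems)
  have bi: "pair_bidirected_digraph G" by unfold_locales
  show ?case
  proof (cases "\<forall>e\<in>parcs G. w e = 1")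
    case True
    have "gdist (G, \<lambda>_. 1) u v \<le> gdist (G, \<lambda>e. real (w e)) u v" for u v
    proof (rule gdist_le_gdist[OF less.prems(1) less.prems(1)])
      fix u v assume "(u, v) \<in> parcs G"
      then show "\<exists>p. G.awalk u p v \<and> G.awalk_cost (\<lambda>_. 1) p \<le> real (w (u, v))"
        using True by (intro exI[of _ "[(u, v)]"]) (auto simp: G.awalk_simps dest: G.wellformed')
    qed simp
    then show ?thesis
      using True less.prems(3) subdivision_pair_base[OF bi]
      by (intro exI[of _ G] exI[of _ \<phi>]) force
  next
    case False
    then obtain a b where ab: "(a, b) \<in> parcs G" "w (a, b) \<noteq> 1"
      by auto
    then have W: "2 \<le> w (a, b)" "w (b, a) = w (a, b)" and ba: "(b, a) \<in> parcs G"
      using less.prems(2)[of a b] G.arcs_symmetric by auto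
    obtain z where z: "z \<notin> pverts G"
      using ex_new_if_finite[OF assms(1) G.pair_finite_verts] by blast
    have V: "a \<in> pverts G" "b \<in> pverts G" "a \<noteq> b" "a \<noteq> z" "b \<noteq> z"
      using ab(1) z G.no_loops' by (auto dest: G.wellformed')
    define G1 where "G1 = subdivide G (a, b) z"
    have G1: "pair_graph G1"
      unfolding G1_def using ab(1) z by (rule G.pair_graph_subdivide)
    interpret G1: pair_graph G1 by (rule G1)
    have arcs1: "parcs G1 = (parcs G - {(a, b), (b, a)}) \<union> {(a, z), (z, a), (z, b), (b, z)}"
      by (simp add: G1_def)
    have verts1: "pverts G1 = insert z (pverts G)"
      by (simp add: G1_def)
    have zG: "(z, u) \<notin> parcs G" "(u, z) \<notin> parcs G" for u
      using z by (auto dest: G.wellformed')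
    define w1 where "w1 e = (if e \<in> {(a, z), (z, a)} then 1
        else if e \<in> {(z, b), (b, z)} then w (a, b) - 1 else w e)" for e
    \<comment> \<open>The new vertex \<open>z\<close> lies at distance 1 from \<open>a\<close> on an
      edge of length \<open>w (a, b)\<close>, so \<open>t\<close> is its relative position, used for
      linear interpolation.\<close>
    define t where "t = 1 / real (w (a, b))"
    define \<phi>1 where "\<phi>1 i u = (if u = z then \<phi> i a + t * (\<phi> i b - \<phi> i a) else \<phi> i u)" for i u
    have arcs1_cases: "(u, v) \<in> {(a, z), (z, a)} \<or> (u, v) \<in> {(z, b), (b, z)} \<or>
        (u, v) \<in> parcs G \<and> u \<noteq> z \<and> v \<noteq> z" if "(u, v) \<in> parcs G1" for u v
      using that zG unfolding arcs1 by blast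
    have sym1: "1 \<le> w1 (u, v) \<and> w1 (v, u) = w1 (u, v)" if "(u, v) \<in> parcs G1" for u v
      using arcs1_cases[OF that]
    proof (elim disjE conjE)
      assume "(u, v) \<in> parcs G" "u \<noteq> z" "v \<noteq> z"
      then show ?thesis
        using less.prems(2)[of u v] by (simp add: w1_def)
    qed (use W(1) V in \<open>auto simp: w1_def\<close>)
    have t: "t * real (w (a, b)) = 1" "0 \<le> t"
      using W(1) by (auto simp: t_def)
    have bd: "\<bar>\<phi> i b - \<phi> i a\<bar> \<le> real (w (a, b))" for i
      using less.prems(3)[OF ab(1), of i] less.prems(3)[OF ba, of i] W(2) by auto
    have t1: "\<bar>t * (\<phi> i b - \<phi> i a)\<bar> \<le> 1" for i
    proof -
      have "\<bar>t * (\<phi> i b - \<phi> i a)\<bar> = t * \<bar>\<phi> i b - \<phi> i a\<bar>"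
        using t(2) by (simp add: abs_mult)
      also have "\<dots> \<le> t * real (w (a, b))"
        using bd[of i] t(2) by (intro mult_left_mono) auto
      finally show ?thesis using t(1) by simp
    qed
    have t2: "\<bar>(1 - t) * (\<phi> i b - \<phi> i a)\<bar> \<le> real (w (a, b) - 1)" for i
    proof -
      have "t \<le> 1" using W(1) by (simp add: t_def)
      then have "\<bar>(1 - t) * (\<phi> i b - \<phi> i a)\<bar> = (1 - t) * \<bar>\<phi> i b - \<phi> i a\<bar>"
        by (simp add: abs_mult)
      also have "\<dots> \<le> (1 - t) * real (w (a, b))"
        using bd[of i] \<open>t \<le> 1\<close> by (intro mult_left_mono) auto
      also have "\<dots> = real (w (a, b) - 1)"
        using t(1) W(1) by (simp add: left_diff_distrib of_nat_diff)
      finally show ?thesis .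
    qed
    have lip1: "\<phi>1 i u - \<phi>1 i v \<le> real (w1 (u, v))" if uv1: "(u, v) \<in> parcs G1" for i u v
    proof -
      have z1: "\<phi>1 i z - \<phi>1 i a = t * (\<phi> i b - \<phi> i a)"
        and z2: "\<phi>1 i b - \<phi>1 i z = (1 - t) * (\<phi> i b - \<phi> i a)"
        using V by (auto simp: \<phi>1_def algebra_simps)
      consider "(u, v) \<in> {(a, z), (z, a)}" | "(u, v) \<in> {(z, b), (b, z)}"
        | "(u, v) \<in> parcs G" "u \<noteq> z" "v \<noteq> z"
        using arcs1_cases[OF uv1] by blast
      then show ?thesis
      proof cases
        case 1
        then show ?thesis
          using z1 t1[of i] by (auto simp: w1_def)
      next
        case 2
        then show ?thesis
          using z2 t2[of i] V by (auto simp: w1_def)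
      next
        case 3
        then show ?thesis
          using less.prems(3)[of u v i] by (auto simp: w1_def \<phi>1_def)
      qed
    qed
    \<comment> \<open>Counting both arcs, the split edge contributed
      \<open>2 * (w (a, b) - 1)\<close> to the excess; its two halves contribute \<open>0\<close>
      and \<open>2 * (w (a, b) - 2)\<close>.\<close>
    have decr: "(\<Sum>e\<in>parcs G1. w1 e - 1) < (\<Sum>e\<in>parcs G. w e - 1)"
    proof -
      let ?C = "parcs G - {(a, b), (b, a)}"
      have "(\<Sum>e\<in>parcs G1. w1 e - 1) = (\<Sum>e\<in>?C. w1 e - 1) + (\<Sum>e\<in>{(a, z), (z, a), (z, b), (b, z)}. w1 e - 1)"
        unfolding arcs1 using zG G.pair_finite_arcs by (intro sum.union_disjoint) auto
      also have "(\<Sum>e\<in>?C. w1 e - 1) = (\<Sum>e\<in>?C. w e - 1)"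
        using zG by (intro sum.cong) (auto simp: w1_def)
      also have "(\<Sum>e\<in>{(a, z), (z, a), (z, b), (b, z)}. w1 e - 1) = 2 * (w (a, b) - 2)"
        using V by (auto simp: w1_def)
      also have "(\<Sum>e\<in>?C. w e - 1) + 2 * (w (a, b) - 2) < (\<Sum>e\<in>?C. w e - 1) + (\<Sum>e\<in>{(a, b), (b, a)}. w e - 1)"
        using V W by auto
      also have "\<dots> = (\<Sum>e\<in>parcs G. w e - 1)"
        using ab(1) ba G.pair_finite_arcs by (intro sum.subset_diff[symmetric]) auto
      finally show ?thesis .
    qed
    obtain G' \<phi>' where IH: "subdivision_pair G1 G'" "pverts G1 \<subseteq> pverts G'"
      "\<forall>i. \<forall>u\<in>pverts G1. \<phi>' i u = \<phi>1 i u" "\<forall>i. \<forall>(u, v)\<in>parcs G'. \<phi>' i u - \<phi>' i v \<le> 1"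
      "\<forall>u v. gdist (G', \<lambda>_. 1) u v \<le> gdist (G1, \<lambda>e. real (w1 e)) u v"
      using less.hyps[OF decr G1, of \<phi>1, OF sym1 lip1] by blast
    have "subdivision_pair G G1"
      unfolding G1_def using ab(1) z subdivision_pair_base[OF bi] by (rule subdivision_pair_divide)
    then have "subdivision_pair G G'"
      using IH(1) by (rule subdivision_trans)
    \<comment> \<open>The arc \<open>(a, b)\<close> is replaced by the path through
      \<open>z\<close>, of cost \<open>1 + (w (a, b) - 1)\<close>; likewise for
      \<open>(b, a)\<close>.\<close>
    moreover have "gdist (G1, \<lambda>e. real (w1 e)) u v \<le> gdist (G, \<lambda>e. real (w e)) u v" for u v
    proof (rule gdist_le_gdist[OF less.prems(1) G1])
      fix u v assume uv: "(u, v) \<in> parcs G"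
      then consider "(u, v) = (a, b)" | "(u, v) = (b, a)" | "(u, v) \<in> parcs G1"
        by (auto simp: arcs1)
      then show "\<exists>p. G1.awalk u p v \<and> G1.awalk_cost w1 p \<le> real (w (u, v))"
      proof cases
        case 1
        then show ?thesis
          using V W(1) by (intro exI[of _ "[(a, z), (z, b)]"])
            (auto simp: G1.awalk_simps arcs1 verts1 w1_def of_nat_diff)
      next
        case 2
        then show ?thesis
          using V W by (intro exI[of _ "[(b, z), (z, a)]"])
            (auto simp: G1.awalk_simps arcs1 verts1 w1_def of_nat_diff)
      next
        case 3
        then show ?thesis
          using uv zG by (intro exI[of _ "[(u, v)]"])
            (auto simp: G1.awalk_simps w1_def dest: G1.wellformed')
      qed
    qed (auto simp: verts1)
    ultimately show ?thesis
      using IH z by (intro exI[of _ G'] exI[of _ \<phi>'] conjI)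
        (auto simp: verts1 \<phi>1_def intro: order_trans[OF IH(5)[rule_format]])
  qed
qed

section \<open>Infinite dimension\<close>

text \<open>The common core of all three claims: at a scale proportional to \<open>K\<close>, with
  factor depending only on \<open>d\<close>, the bound on diameters must be at least
  \<open>t\<close> times \<open>K\<close>, where \<open>t\<close> is arbitrary. \<open>K\<close> may
  depend on \<open>t\<close>; the free factor \<open>s\<close> allows it to be scaled away.\<close>

lemma all_minors_not_colouring:
  fixes \<G> :: "'a pair_pre_digraph set" and t :: real
  assumes pg: "\<forall>G \<in> \<G>. pair_graph G"
    and minors: "\<forall>H :: nat pair_pre_digraph. pair_graph H \<longrightarrow> (\<exists>G \<in> \<G>. minor H G)"
  obtains G K w where "G \<in> \<G>" "0 < K" "\<And>e. 1 \<le> w e" "\<And>u v. w (v, u) = w (u, v)"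
    "\<And>s D c. 0 < s \<Longrightarrow> D < s * real K * t \<Longrightarrow>
       \<not> colouring (G, \<lambda>e. s * real (w e)) d (s * real K * real (2 * d + 1)) D c"
    "\<exists>G'. subdivision_pair G G' \<and> (\<forall>D c. D < real K * t \<longrightarrow>
       \<not> colouring (G', \<lambda>_. 1) d (real K * real (2 * d + 1)) D c)"
proof -
  \<comment> \<open>Large enough for \<open>p - 2\<close>, the coordinate difference guaranteed
    along the monochromatic path, to be at least \<open>t\<close>.\<close>
  define p where "p = nat \<lceil>t\<rceil> + 3"
  have p: "0 < p" "t \<le> real p - 2"
    unfolding p_def by (auto, linarith)
  obtain G where "G \<in> \<G>" and minor: "minor (grid d p) G"
    using minor_nat_imp_minor[OF minors pair_graph_grid] by blast
  then have G: "pair_graph G"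
    using pg by blast
  interpret G: pair_graph G by (rule G)
  \<comment> \<open>The potentials come from the coordinate functions. They change by at most 2
    along an arc of the grid, whence the factor \<open>2 * d + 1\<close>.\<close>
  obtain K w \<rho> \<phi> where K: "0 < K" and \<rho>: "\<And>x. x \<in> pverts (grid d p) \<Longrightarrow> \<rho> x \<in> pverts G"
    and w1: "\<And>e. 1 \<le> w e" and w_sym: "\<And>u v. w (v, u) = w (u, v)"
    and lip: "\<And>i u v. i < d \<Longrightarrow> \<phi> i u - \<phi> i v \<le> int (w (u, v))"
    and \<phi>: "\<And>i x. x \<in> pverts (grid d p) \<Longrightarrow> \<phi> i (\<rho> x) = int K * int (x i)"
    and walk: "\<And>x y. (x, y) \<in> parcs (grid d p) \<Longrightarrow> \<exists>q. G.awalk (\<rho> x) q (\<rho> y) \<and>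
       sum_list (map w q) \<le> (d * 2 + 1) * K"
    by (rule minor_weights[OF G minor pair_graph_grid, of d "\<lambda>i x. int (x i)" 2])
      (auto simp: grid_def)
  have lip': "real_of_int (\<phi> i u) - real_of_int (\<phi> i v) \<le> real (w (u, v))" if "i < d" for i u v
    using lip[OF that, of u v] by linarith
  have up: "gdist (G, \<lambda>e. s * real (w e)) (\<rho> x) (\<rho> y) \<le> ereal (s * real K * real (2 * d + 1))"
    if "0 < s" "(x, y) \<in> parcs (grid d p)" for s x y
  proof -
    obtain q where q: "G.awalk (\<rho> x) q (\<rho> y)" "sum_list (map w q) \<le> (d * 2 + 1) * K"
      using walk \<open>(x, y) \<in> _\<close> by blast
    have "G.awalk_cost (\<lambda>e. s * real (w e)) q = s * real (sum_list (map w q))"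
      unfolding G.awalk_cost_def by (induction q) (auto simp: algebra_simps)
    also have "\<dots> \<le> s * real ((d * 2 + 1) * K)"
      using q(2) \<open>0 < s\<close> by (intro mult_left_mono) (simp_all only: of_nat_le_iff less_imp_le)
    also have "\<dots> = s * real K * real (2 * d + 1)"
      by (simp add: algebra_simps)
    finally show ?thesis
      using gdist_le_awalk_cost[OF G q(1), of "\<lambda>e. s * real (w e)"] by (meson ereal_less_eq(3) order_trans)
  qed
  have "\<not> colouring (G, \<lambda>e. s * real (w e)) d (s * real K * real (2 * d + 1)) D c"
    if s: "0 < s" and D: "D < s * real K * t" for s D c
  proof (rule grid_not_colouring[OF p(1)])
    fix i x y assume "i < d" "x \<in> pverts (grid d p)" "y \<in> pverts (grid d p)"
    moreover have "ereal (s * \<phi> i (\<rho> x) - s * \<phi> i (\<rho> y)) \<le> gdist (G, \<lambda>e. s * real (w e)) (\<rho> x) (\<rho> y)"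
      using lip'[OF \<open>i < d\<close>] s by (intro gdist_ge_potential[OF G]) (simp flip: right_diff_distrib)
    ultimately show "ereal (s * real K * (real (x i) - real (y i)))
        \<le> gdist (G, \<lambda>e. s * real (w e)) (\<rho> x) (\<rho> y)"
      using \<phi> by (simp add: algebra_simps)
  next
    have "s * real K * t \<le> s * real K * (real p - 2)"
      using p(2) s by (intro mult_left_mono) auto
    with D show "D < s * real K * (real p - 2)" by linarith
  qed (use s \<rho> up in auto)
  moreover have "\<exists>G'. subdivision_pair G G' \<and> (\<forall>D c. D < real K * t \<longrightarrow>
       \<not> colouring (G', \<lambda>_. 1) d (real K * real (2 * d + 1)) D c)"
  proof -
    \<comment> \<open>The subdivision lemma wants a Lipschitz bound for every index, but
      \<open>\<phi> i\<close> has one only for \<open>i < d\<close>; the others are replaced by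
      0.\<close>
    define \<psi> where "\<psi> i u = (if i < d then real_of_int (\<phi> i u) else 0)" for i u
    have "\<exists>G' \<psi>'. subdivision_pair G G' \<and> pverts G \<subseteq> pverts G' \<and>
      (\<forall>i. \<forall>u\<in>pverts G. \<psi>' i u = \<psi> i u) \<and>
      (\<forall>i. \<forall>(u, v)\<in>parcs G'. \<psi>' i u - \<psi>' i v \<le> 1) \<and>
      (\<forall>u v. gdist (G', \<lambda>_. 1) u v \<le> gdist (G, \<lambda>e. real (w e)) u v)"
      using lip' w1 w_sym
      by (intro subdivide_to_unit_weights infinite_UNIV_if_all_minors[OF minors] G) (auto simp: \<psi>_def)
    then obtain G' \<psi>' where sub: "subdivision_pair G G'" and V: "pverts G \<subseteq> pverts G'"
      and \<psi>': "\<forall>i. \<forall>u\<in>pverts G. \<psi>' i u = \<psi> i u"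
      and lip1: "\<forall>i. \<forall>(u, v)\<in>parcs G'. \<psi>' i u - \<psi>' i v \<le> 1"
      and le: "\<forall>u v. gdist (G', \<lambda>_. 1) u v \<le> gdist (G, \<lambda>e. real (w e)) u v"
      by (elim exE conjE)
    have G': "pair_graph G'"
      using sub by (rule G.pair_graph_subdivision)
    \<comment> \<open>The points \<open>\<rho> x\<close> remain vertices of \<open>G'\<close>. Their
      distances have not increased, and the interpolated potentials still take the old values
      there.\<close>
    have "\<not> colouring (G', \<lambda>_. 1) d (real K * real (2 * d + 1)) D c" if D: "D < real K * t" for D c
    proof (rule grid_not_colouring[OF p(1)])
      fix x y assume "(x, y) \<in> parcs (grid d p)"
      then show "gdist (G', \<lambda>_. 1) (\<rho> x) (\<rho> y) \<le> ereal (real K * real (2 * d + 1))"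
        using up[of 1 x y] le by (auto intro: order_trans)
    next
      fix i x y assume "i < d" "x \<in> pverts (grid d p)" "y \<in> pverts (grid d p)"
      moreover have "ereal (\<psi>' i (\<rho> x) - \<psi>' i (\<rho> y)) \<le> gdist (G', \<lambda>_. 1) (\<rho> x) (\<rho> y)"
        using lip1 by (intro gdist_ge_potential[OF G']) auto
      ultimately show "ereal (real K * (real (x i) - real (y i))) \<le> gdist (G', \<lambda>_. 1) (\<rho> x) (\<rho> y)"
        using \<phi> \<psi>' \<rho> by (simp add: \<psi>_def algebra_simps)
    next
      have "real K * t \<le> real K * (real p - 2)"
        using p(2) by (intro mult_left_mono) auto
      with D show "D < real K * (real p - 2)" by linarith
    qed (use \<rho> V in auto)
    with sub show ?thesis by blast
  qed
  ultimately show ?thesis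
    using that[of G K w] \<open>G \<in> \<G>\<close> K w1 w_sym by blast
qed

theorem theorem28:
  fixes \<G> :: "'a pair_pre_digraph set"
  assumes "\<forall>G \<in> \<G>. pair_graph G"
    and "\<forall>H :: nat pair_pre_digraph. pair_graph H \<longrightarrow> (\<exists>G \<in> \<G>. minor H G)"
  shows "asdim (weights_completion {0<..} \<G>) = \<infinity> \<and>
         ANdim (weights_completion (real ` {1..}) \<G>) = \<infinity> \<and>
         (closed_under_subdivision \<G> \<longrightarrow> ANdim (unit_weights \<G>) = \<infinity>)"
proof (intro conjI impI)
  note obstruction = all_minors_not_colouring[OF assms]
  have "\<not> control_function n f (weights_completion {0<..} \<G>)" for n f
  proof
    assume f: "control_function n f (weights_completion {0<..} \<G>)"
    define R where "R = real (2 * (n + 1) + 1)"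
    \<comment> \<open>Since \<open>R\<close> depends on \<open>n\<close> alone, \<open>f R\<close>
      is known before \<open>K\<close> is chosen. With \<open>s = 1 / K\<close> the scale becomes
      \<open>R\<close> and the bound \<open>f R + 1\<close>, out of reach of
      \<open>f R\<close>.\<close>
    obtain G K w where G: "G \<in> \<G>" "0 < K" and w: "\<And>e. 1 \<le> w e" "\<And>u v. w (v, u) = w (u, v)"
      and no: "\<And>s D c. 0 < s \<Longrightarrow> D < s * real K * (f R + 1) \<Longrightarrow>
         \<not> colouring (G, \<lambda>e. s * real (w e)) (n + 1) (s * real K * R) D c"
      unfolding R_def by (rule obstruction[where d = "n + 1" and t = "f R + 1"]) (rule that, unfold R_def)
    have "0 < w e" for e
      using w(1)[of e] by linarith
    then have "(G, \<lambda>e. 1 / real K * real (w e)) \<in> weights_completion {0<..} \<G>"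
      using G w(2) by (auto simp: weights_completion_def)
    moreover have "0 < R" by (simp add: R_def)
    ultimately obtain c where "colouring (G, \<lambda>e. 1 / real K * real (w e)) (n + 1) R (f R) c"
      using f unfolding control_function_def by blast
    then show False
      using no[of "1 / real K" "f R" c] G(2) by simp
  qed
  then show "asdim (weights_completion {0<..} \<G>) = \<infinity>"
    by (simp add: asdim_def top_enat_def)
  have "\<not> control_function n f (weights_completion (real ` {1..}) \<G>)" if f': "dilation f" for n f
  proof
    assume f: "control_function n f (weights_completion (real ` {1..}) \<G>)"
    obtain C where C: "\<And>r. 0 < r \<Longrightarrow> f r \<le> C * r"
      using f' by (auto simp: dilation_def)
    define R where "R = real (2 * (n + 1) + 1)"
    \<comment> \<open>Integer weights force \<open>s = 1\<close>, so the scale \<open>K * R\<close>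
      is known only after \<open>t\<close> has been chosen. The dilation bound
      \<open>f (K * R) \<le> C * K * R\<close> is linear in \<open>K\<close>, hence
      \<open>t = C * R + 1\<close> suffices.\<close>
    obtain G K w where G: "G \<in> \<G>" "0 < K" and w: "\<And>e. 1 \<le> w e" "\<And>u v. w (v, u) = w (u, v)"
      and no: "\<And>s D c. 0 < s \<Longrightarrow> D < s * real K * (C * R + 1) \<Longrightarrow>
         \<not> colouring (G, \<lambda>e. s * real (w e)) (n + 1) (s * real K * R) D c"
      unfolding R_def by (rule obstruction[where d = "n + 1" and t = "C * R + 1"]) (rule that, unfold R_def)
    have "(G, \<lambda>e. real (w e)) \<in> weights_completion (real ` {1..}) \<G>"
      using G w by (auto simp: weights_completion_def)
    moreover have R: "0 < real K * R" using G by (simp add: R_def)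
    ultimately obtain c where "colouring (G, \<lambda>e. real (w e)) (n + 1) (real K * R) (f (real K * R)) c"
      using f unfolding control_function_def by blast
    moreover have "f (real K * R) < real K * (C * R + 1)"
      using C[OF R] G(2) by (simp add: algebra_simps)
    ultimately show False
      using no[of 1 "f (real K * R)" c] by simp
  qed
  then have "{n. \<exists>f. control_function n f (weights_completion (real ` {1..}) \<G>) \<and> dilation f} = {}"
    by blast
  then show "ANdim (weights_completion (real ` {1..}) \<G>) = \<infinity>"
    by (simp only: ANdim_def image_empty Inf_enat_def refl if_True)
  assume closed: "closed_under_subdivision \<G>"
  have "\<not> control_function n f (unit_weights \<G>)" if f': "dilation f" for n f
  proof
    assume f: "control_function n f (unit_weights \<G>)"
    obtain C where C: "\<And>r. 0 < r \<Longrightarrow> f r \<le> C * r"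
      using f' by (auto simp: dilation_def)
    define R where "R = real (2 * (n + 1) + 1)"
    \<comment> \<open>The same choice of \<open>t\<close>, now applied to the unit-weight
      subdivision \<open>G'\<close>, which belongs to the class by closure.\<close>
    obtain G K where G: "G \<in> \<G>" "0 < K" and "\<exists>G'. subdivision_pair G G' \<and>
        (\<forall>D c. D < real K * (C * R + 1) \<longrightarrow> \<not> colouring (G', \<lambda>_. 1) (n + 1) (real K * R) D c)"
      unfolding R_def by (rule obstruction[where d = "n + 1" and t = "C * R + 1"]) (rule that, unfold R_def)
    then obtain G' where sub: "subdivision_pair G G'"
      and no: "\<And>D c. D < real K * (C * R + 1) \<Longrightarrow>
         \<not> colouring (G', \<lambda>_. 1) (n + 1) (real K * R) D c"
      by blast
    have "(G', \<lambda>_. 1) \<in> unit_weights \<G>"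
      using closed G(1) sub by (auto simp: closed_under_subdivision_def unit_weights_def)
    moreover have R: "0 < real K * R" using G by (simp add: R_def)
    ultimately obtain c where "colouring (G', \<lambda>_. 1) (n + 1) (real K * R) (f (real K * R)) c"
      using f unfolding control_function_def by blast
    moreover have "f (real K * R) < real K * (C * R + 1)"
      using C[OF R] G(2) by (simp add: algebra_simps)
    ultimately show False
      using no by blast
  qed
  then have "{n. \<exists>f. control_function n f (unit_weights \<G>) \<and> dilation f} = {}"
    by blast
  then show "ANdim (unit_weights \<G>) = \<infinity>"
    by (simp only: ANdim_def image_empty Inf_enat_def refl if_True)
qed

end
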